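(* Let $(k_j)_{j=0}^\infty$ be a strictly increasing sequence of nonnegative integers, with range $K$, such that $k_{j+1}>2k_j$ for all $j\ge 0$. Then the smallest constant $C_K$ for which $$\|A_v\|_\infty\le C_K\|v\|_2\quad\text{for all complex sequences } v=(v_j)_{j=0}^\infty\in\ell^2$$ is $C_K=\sqrt2$.
   Context: Here $\ell^2$ is the space of square-summable complex sequences indexed by the nonnegative integers, with norm $\|\cdot\|_2$. Given $K$ and $v$, let $a_v$ be the function on the nonnegative integers with $a_v(k_j)=v_j$ for all $j$ and $a_v(n)=0$ when $n\notin K$. The matrix $A_v$ is the semi-infinite (Hankel) matrix with entries $A_v(m,n)=a_v(m+n)$ for integers $m,n\ge 0$. For a semi-infinite matrix $A=(A(m,n))_{m,n\ge0}$, $$\|A\|_\infty=\sup\left\{\left|\sum_{m=0}^\infty\sum_{n=0}^\infty A(m,n)g(m)h(n)\right| : g,h\in F\right\},$$ where $F$ is the set of all finitely supported sequences in the unit ball of $\ell^2$. This is the usual operator norm on $\ell^2$ when $A$ represents a bounded operator on $\ell^2$, and equals $\infty$ otherwise. *)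

theory Defs
  imports Complex_Main "HOL-Library.Extended_Real"
begin

definition ell2 :: "(nat \<Rightarrow> complex) set" where
  "ell2 = {v. summable (\<lambda>j. (cmod (v j))\<^sup>2)}"

definition ell2_norm :: "(nat \<Rightarrow> complex) \<Rightarrow> real" where
  "ell2_norm v = sqrt (\<Sum>j. (cmod (v j))\<^sup>2)"

definition finsupp_unit_ball :: "(nat \<Rightarrow> complex) set" where
  "finsupp_unit_ball = {g. finite {n. g n \<noteq> 0} \<and> g \<in> ell2 \<and> ell2_norm g \<le> 1}"

(* Both series have finitely many nonzero terms, so suminf is an honest sum here
   for an arbitrary matrix A. The supremum is infinite when A is unbounded. *)
definition matrix_norm :: "(nat \<Rightarrow> nat \<Rightarrow> complex) \<Rightarrow> ereal" where
  "matrix_norm A =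
     (SUP (g, h) \<in> finsupp_unit_ball \<times> finsupp_unit_ball.
        ereal (cmod (\<Sum>m. \<Sum>n. A m n * g m * h n)))"

(* For injective k, inv k n is the unique j with k j = n when n is in range k. *)
definition lacunary_coeff :: "(nat \<Rightarrow> nat) \<Rightarrow> (nat \<Rightarrow> complex) \<Rightarrow> nat \<Rightarrow> complex" where
  "lacunary_coeff k v n = (if n \<in> range k then v (inv k n) else 0)"

definition lacunary_hankel :: "(nat \<Rightarrow> nat) \<Rightarrow> (nat \<Rightarrow> complex) \<Rightarrow> nat \<Rightarrow> nat \<Rightarrow> complex" where
  "lacunary_hankel k v m n = lacunary_coeff k v (m + n)"

end

(* Join m and n by an edge labelled i whenever m + n = k i. Lacunarity makes this graph a forest
   (with possible loops at roots) in which every edge from a vertex to a larger one carries a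
   larger label than the edge to the smaller neighbour, if there is one.

   Upper bound: with S N = sqrt (2 * (\<Sum>i<N. |v i|^2)), split |v i| x y by the arithmetic-geometric
   mean inequality, giving weight S (i + 1) to the larger endpoint of an edge labelled i and
   S (i + 1) - S i to the smaller one. The weights at a fixed vertex telescope to at most
   sqrt 2 * norm v.

   Sharpness: for v i = sqrt i with 1 \<le> i \<le> N, the function w defined by w 0 = 1 and multiplied
   by 1 / sqrt i along each edge labelled i away from the root 0 is an eigenvector with eigenvalue
   N, while norm v = sqrt (N (N + 1) / 2). *)
theory Submission
  imports Defs
begin

section \<open>Finitely supported vectors and the bilinear form\<close>

lemma ell2_norm_finsupp:
  assumes "\<And>n. n \<ge> M \<Longrightarrow> g n = 0"
  shows "g \<in> ell2" and "ell2_norm g = sqrt (\<Sum>n<M. (cmod (g n))\<^sup>2)"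
proof -
  have z: "(cmod (g n))\<^sup>2 = 0" if "n \<notin> {..<M}" for n
    using assms that by simp
  show "g \<in> ell2"
    unfolding ell2_def mem_Collect_eq by (rule summable_finite[of "{..<M}"]) (simp_all add: z)
  show "ell2_norm g = sqrt (\<Sum>n<M. (cmod (g n))\<^sup>2)"
    unfolding ell2_norm_def by (subst suminf_finite[of "{..<M}"]) (simp_all add: z)
qed

text \<open>Injectivity leaves at most one nonzero term. Writing the coefficient as a finite sum
  over labels allows summations to be exchanged in the bilinear form.\<close>

lemma lacunary_coeff_eq_sum:
  assumes "inj k" and "\<And>i. k i = s \<Longrightarrow> i < N"
  shows "lacunary_coeff k v s = (\<Sum>i<N. if k i = s then v i else 0)"
proof (cases "s \<in> range k")
  case True
  then obtain j where j: "s = k j" by blast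
  have "(\<Sum>i<N. if k i = s then v i else 0) = (\<Sum>i<N. if i = j then v i else 0)"
    using assms(1) by (intro sum.cong) (auto simp: j inj_eq)
  also have "\<dots> = v j" using assms(2) j by simp
  finally show ?thesis
    using assms(1) by (simp add: lacunary_coeff_def j)
next
  case False
  then have "(\<Sum>i<N. if k i = s then v i else 0) = 0"
    by (intro sum.neutral) auto
  then show ?thesis using False by (simp add: lacunary_coeff_def)
qed

text \<open>Groups the index pairs by the label of the edge joining them; pairs joined by no edge
  contribute nothing.\<close>

lemma lacunary_hankel_form:
  fixes k :: "nat \<Rightarrow> nat"
  assumes k: "strict_mono k"
    and g: "\<And>n. n \<ge> M \<Longrightarrow> g n = 0" and h: "\<And>n. n \<ge> M \<Longrightarrow> h n = 0"
  shows "(\<Sum>m. \<Sum>n. lacunary_hankel k v m n * g m * h n) =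
         (\<Sum>i<2*M. v i * (\<Sum>m\<le>k i. g m * h (k i - m)))"
proof -
  have "(\<Sum>m. \<Sum>n. lacunary_hankel k v m n * g m * h n) =
        (\<Sum>m. \<Sum>n<M. lacunary_hankel k v m n * g m * h n)"
    by (intro suminf_cong suminf_finite) (auto simp: h)
  also have "\<dots> = (\<Sum>m<M. \<Sum>n<M. lacunary_hankel k v m n * g m * h n)"
    by (intro suminf_finite) (auto simp: g)
  also have "\<dots> = (\<Sum>m<M. \<Sum>n<M. \<Sum>i<2*M. if k i = m + n then v i * (g m * h n) else 0)"
  proof (intro sum.cong refl)
    fix m n assume "m \<in> {..<M}" "n \<in> {..<M}"
    \<comment> \<open>Labels below \<open>2 * M\<close> suffice, because
      \<open>i \<le> k i = m + n < 2 * M\<close>.\<close>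
    then have "i < 2 * M" if "k i = m + n" for i
      using strict_mono_imp_increasing[OF k, of i] that by simp
    then show "lacunary_hankel k v m n * g m * h n =
        (\<Sum>i<2*M. if k i = m + n then v i * (g m * h n) else 0)"
      unfolding lacunary_hankel_def
      using lacunary_coeff_eq_sum[OF strict_mono_imp_inj_on[OF k], of "m + n" "2 * M" v]
      by (simp add: sum_distrib_right mult.assoc if_distrib[of "\<lambda>x. x * _"] cong: if_cong)
  qed
  also have "\<dots> = (\<Sum>m<M. \<Sum>i<2*M. \<Sum>n<M. if k i = m + n then v i * (g m * h n) else 0)"
    by (intro sum.cong refl sum.swap)
  also have "\<dots> = (\<Sum>i<2*M. \<Sum>m<M. \<Sum>n<M. if k i = m + n then v i * (g m * h n) else 0)"
    by (rule sum.swap)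
  also have "\<dots> = (\<Sum>i<2*M. v i * (\<Sum>m\<le>k i. g m * h (k i - m)))"
  proof (rule sum.cong[OF refl])
    fix i
    have "(\<Sum>n<M. if k i = m + n then v i * (g m * h n) else 0) =
        (if m \<le> k i then v i * (g m * h (k i - m)) else 0)" for m
    proof -
      \<comment> \<open>The guard \<open>m \<le> k i\<close> excludes the spurious solution
        \<open>n = 0\<close> that truncated subtraction would give.\<close>
      have "(\<Sum>n<M. if k i = m + n then v i * (g m * h n) else 0) =
          (\<Sum>n<M. if n = k i - m then (if m \<le> k i then v i * (g m * h n) else 0) else 0)"
        by (intro sum.cong) auto
      \<comment> \<open>If \<open>k i - m \<ge> M\<close>, this index lies outside the sum, but then
        \<open>h (k i - m) = 0\<close>.\<close>
      also have "\<dots> = (if m \<le> k i then v i * (g m * h (k i - m)) else 0)"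
        using h by (simp add: not_less)
      finally show ?thesis .
    qed
    then have "(\<Sum>m<M. \<Sum>n<M. if k i = m + n then v i * (g m * h n) else 0) =
        (\<Sum>m<M. if m \<le> k i then v i * (g m * h (k i - m)) else 0)" by simp
    also have "\<dots> = (\<Sum>m\<in>{..<M} \<inter> {..k i}. v i * (g m * h (k i - m)))"
      by (subst sum.inter_restrict) auto
    also have "\<dots> = (\<Sum>m\<le>k i. v i * (g m * h (k i - m)))"
      by (intro sum.mono_neutral_left) (use g leI in auto)
    also have "\<dots> = v i * (\<Sum>m\<le>k i. g m * h (k i - m))"
      by (simp add: sum_distrib_left)
    finally show "(\<Sum>m<M. \<Sum>n<M. if k i = m + n then v i * (g m * h n) else 0) = \<dots>" .
  qed
  finally show ?thesis .
qed

section \<open>Upper bound by edge weights\<close>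

lemma am_gm_weighted:
  fixes a b c x y :: real
  assumes "0 \<le> a" "0 \<le> b" "0 \<le> c" "0 \<le> x" "0 \<le> y" "c\<^sup>2 \<le> a * b"
  shows "c * (x * y) \<le> (a * x\<^sup>2 + b * y\<^sup>2) / 2"
proof -
  have "c \<le> sqrt a * sqrt b"
    using real_le_rsqrt[OF assms(6)] by (simp add: real_sqrt_mult)
  then have "c * (x * y) \<le> (sqrt a * sqrt b) * (x * y)"
    using assms by (intro mult_right_mono) auto
  moreover have "0 \<le> (sqrt a * x - sqrt b * y)\<^sup>2" by simp
  ultimately show ?thesis
    using assms by (simp add: power2_diff power_mult_distrib algebra_simps)
qed

text \<open>This is \<open>S N\<close> of the overview. The factor 2 makes up for the half lost in
  \<open>t * (t - s) \<ge> (t\<^sup>2 - s\<^sup>2) / 2\<close> for consecutive values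
  \<open>s \<le> t\<close>.\<close>

definition root_sum :: "(nat \<Rightarrow> complex) \<Rightarrow> nat \<Rightarrow> real" where
  "root_sum v N = sqrt (2 * (\<Sum>i<N. (cmod (v i))\<^sup>2))"

text \<open>The edge labelled \<open>i\<close> joins \<open>n\<close> to \<open>k i - n\<close>, so
  the test \<open>k i \<le> 2 * n\<close> asks whether \<open>n\<close> is its larger endpoint; at a
  loop the vertex counts as the larger one.\<close>

definition edge_weight :: "(nat \<Rightarrow> nat) \<Rightarrow> (nat \<Rightarrow> complex) \<Rightarrow> nat \<Rightarrow> nat \<Rightarrow> real" where
  "edge_weight k v i n =
     (if k i \<le> 2 * n then root_sum v (Suc i) else root_sum v (Suc i) - root_sum v i)"

lemma root_sum_nonneg: "0 \<le> root_sum v N"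
  by (simp add: root_sum_def sum_nonneg)

lemma root_sum_Suc_mono: "root_sum v N \<le> root_sum v (Suc N)"
  by (simp add: root_sum_def)

lemma root_sum_Suc_sq: "(root_sum v (Suc N))\<^sup>2 = (root_sum v N)\<^sup>2 + 2 * (cmod (v N))\<^sup>2"
  by (simp add: root_sum_def sum_nonneg)

lemma root_sum_le_ell2_norm:
  assumes "v \<in> ell2"
  shows "root_sum v N \<le> sqrt 2 * ell2_norm v"
proof -
  have "(\<Sum>i<N. (cmod (v i))\<^sup>2) \<le> (\<Sum>i. (cmod (v i))\<^sup>2)"
    using assms by (intro sum_le_suminf) (auto simp: ell2_def)
  then show ?thesis
    by (simp add: root_sum_def ell2_norm_def real_sqrt_mult)
qed

lemma edge_weight_nonneg: "0 \<le> edge_weight k v i n"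
  using root_sum_nonneg root_sum_Suc_mono[of v i] by (simp add: edge_weight_def)

text \<open>For consecutive root sums \<open>s \<le> t\<close>, \<open>t * (t - s) - (cmod (v
  i))\<^sup>2 = (t - s)\<^sup>2 / 2 \<ge> 0\<close>. One endpoint carries \<open>t\<close> and the
  other \<open>t - s\<close>, or both carry \<open>t\<close> at a loop.\<close>

lemma edge_weight_mult:
  assumes "m + n = k i"
  shows "(cmod (v i))\<^sup>2 \<le> edge_weight k v i m * edge_weight k v i n"
proof -
  define s t where "s = root_sum v i" and "t = root_sum v (Suc i)"
  have st: "0 \<le> s" "s \<le> t" and sq: "t\<^sup>2 = s\<^sup>2 + 2 * (cmod (v i))\<^sup>2"
    unfolding s_def t_def using root_sum_nonneg root_sum_Suc_mono root_sum_Suc_sq by auto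
  have "0 \<le> (t - s)\<^sup>2" by simp
  then have 1: "(cmod (v i))\<^sup>2 \<le> t * (t - s)"
    using sq by (simp add: power2_eq_square algebra_simps)
  then have 2: "(cmod (v i))\<^sup>2 \<le> t * t"
    using st by (smt (verit) mult_left_mono)
  have "k i \<le> 2 * m \<or> k i \<le> 2 * n"
    using assms by linarith
  then show ?thesis
    using 1 2 by (auto simp: edge_weight_def s_def t_def mult.commute)
qed

text \<open>The weights at \<open>n\<close> telescope: an edge to a larger neighbour costs one
  difference, while an edge to a smaller neighbour, or a loop, costs a whole root sum but has the
  least label at \<open>n\<close>.\<close>

lemma sum_edge_weight_le:
  fixes k :: "nat \<Rightarrow> nat"
  assumes k: "strict_mono k" and lac: "\<And>j. k (Suc j) > 2 * k j"
  shows "(\<Sum>i<N. if n \<le> k i then edge_weight k v i n else 0) \<le> root_sum v N"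
proof (induction N)
  case 0
  then show ?case by (simp add: root_sum_def)
next
  case (Suc N)
  show ?case
  proof (cases "n \<le> k N \<and> k N \<le> 2 * n")
    case True
    \<comment> \<open>Here \<open>2 * k i < k (Suc i) \<le> k N \<le> 2 * n\<close>, so no earlier
      label occurs at \<open>n\<close> and the full weight is added to zero.\<close>
    have "k i < n" if "i < N" for i
    proof -
      have "k (Suc i) \<le> k N"
        using that k by (simp add: strict_mono_less_eq)
      then show ?thesis using lac[of i] True by linarith
    qed
    then have "(\<Sum>i<N. if n \<le> k i then edge_weight k v i n else 0) = 0"
      by (intro sum.neutral) (auto dest: leD)
    then show ?thesis using True by (simp add: edge_weight_def)
  next
    case False
    then show ?thesis
      using Suc.IH root_sum_Suc_mono[of v N] by (auto simp: edge_weight_def)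
  qed
qed

lemma sum_atMost_reflect:
  fixes f :: "nat \<Rightarrow> 'a::comm_monoid_add"
  shows "(\<Sum>m\<le>K. f (K - m)) = (\<Sum>m\<le>K. f m)"
  by (rule sum.reindex_bij_witness[of _ "\<lambda>m. K - m" "\<lambda>m. K - m"]) auto

lemma lacunary_hankel_form_le:
  fixes k :: "nat \<Rightarrow> nat"
  assumes k: "strict_mono k" and lac: "\<And>j. k (Suc j) > 2 * k j"
    and g: "\<And>n. n \<ge> M \<Longrightarrow> g n = 0" and h: "\<And>n. n \<ge> M \<Longrightarrow> h n = 0"
  shows "cmod (\<Sum>m. \<Sum>n. lacunary_hankel k v m n * g m * h n) \<le>
         root_sum v (2 * M) * (((\<Sum>n<M. (cmod (g n))\<^sup>2) + (\<Sum>n<M. (cmod (h n))\<^sup>2)) / 2)"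
proof -
  define w where "w = edge_weight k v"
  define q where "q n = ((cmod (g n))\<^sup>2 + (cmod (h n))\<^sup>2) / 2" for n
  have "cmod (\<Sum>m. \<Sum>n. lacunary_hankel k v m n * g m * h n) =
        cmod (\<Sum>i<2*M. \<Sum>m\<le>k i. v i * (g m * h (k i - m)))"
    by (subst lacunary_hankel_form[OF k g h]) (auto simp: sum_distrib_left)
  also have "\<dots> \<le> (\<Sum>i<2*M. \<Sum>m\<le>k i. cmod (v i * (g m * h (k i - m))))"
    by (intro order.trans[OF norm_sum] sum_mono norm_sum)
  \<comment> \<open>Each edge is charged to its endpoints: \<open>am_gm_weighted\<close> with
    \<open>c = cmod (v i)\<close> and the two endpoint weights as \<open>a\<close> and
    \<open>b\<close>.\<close>
  also have "\<dots> \<le> (\<Sum>i<2*M. \<Sum>m\<le>k i.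
      (w i m * (cmod (g m))\<^sup>2 + w i (k i - m) * (cmod (h (k i - m)))\<^sup>2) / 2)"
    unfolding norm_mult w_def
    by (intro sum_mono am_gm_weighted edge_weight_nonneg edge_weight_mult) auto
  also have "\<dots> = (\<Sum>i<2*M. \<Sum>m\<le>k i. w i m * q m)"
  proof (rule sum.cong[OF refl])
    fix i
    \<comment> \<open>Reversing the summation puts the charge on \<open>h\<close> at the same vertex
      as the charge on \<open>g\<close>, so the two combine into \<open>q\<close>.\<close>
    have "(\<Sum>m\<le>k i. w i (k i - m) * (cmod (h (k i - m)))\<^sup>2) = (\<Sum>m\<le>k i. w i m * (cmod (h m))\<^sup>2)"
      by (rule sum_atMost_reflect)
    then show "(\<Sum>m\<le>k i. (w i m * (cmod (g m))\<^sup>2 + w i (k i - m) * (cmod (h (k i - m)))\<^sup>2) / 2) =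
        (\<Sum>m\<le>k i. w i m * q m)"
      by (simp add: q_def sum.distrib algebra_simps flip: sum_divide_distrib)
  qed
  also have "\<dots> = (\<Sum>i<2*M. \<Sum>m<M. if m \<le> k i then w i m * q m else 0)"
  proof (rule sum.cong[OF refl])
    fix i
    have "(\<Sum>m\<le>k i. w i m * q m) = (\<Sum>m\<in>{..<M} \<inter> {..k i}. w i m * q m)"
      by (rule sum.mono_neutral_right) (auto simp: q_def g h)
    then show "(\<Sum>m\<le>k i. w i m * q m) = (\<Sum>m<M. if m \<le> k i then w i m * q m else 0)"
      by (simp add: sum.inter_restrict)
  qed
  \<comment> \<open>Exchanging the sums collects at each vertex the weights of all its edges, which
    \<open>sum_edge_weight_le\<close> bounds uniformly.\<close>
  also have "\<dots> = (\<Sum>m<M. \<Sum>i<2*M. if m \<le> k i then w i m * q m else 0)"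
    by (rule sum.swap)
  also have "\<dots> = (\<Sum>m<M. (\<Sum>i<2*M. if m \<le> k i then w i m else 0) * q m)"
    by (simp add: sum_distrib_right if_distrib[of "\<lambda>x. x * _"] cong: if_cong)
  also have "\<dots> \<le> (\<Sum>m<M. root_sum v (2 * M) * q m)"
    unfolding w_def
    by (intro sum_mono mult_right_mono sum_edge_weight_le[OF k lac]) (simp add: q_def)
  also have "\<dots> = root_sum v (2 * M) * (((\<Sum>n<M. (cmod (g n))\<^sup>2) + (\<Sum>n<M. (cmod (h n))\<^sup>2)) / 2)"
    by (simp add: q_def sum.distrib flip: sum_distrib_left sum_divide_distrib)
  finally show ?thesis .
qed

text \<open>Phrased for every cut-off from \<open>M\<close> on, so that two vectors can share the
  maximum of their cut-offs.\<close>

lemma finsupp_unit_ballE: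
  assumes "g \<in> finsupp_unit_ball"
  obtains M where "\<And>M' n. M \<le> M' \<Longrightarrow> M' \<le> n \<Longrightarrow> g n = 0"
    and "\<And>M'. M \<le> M' \<Longrightarrow> (\<Sum>n<M'. (cmod (g n))\<^sup>2) \<le> 1"
proof -
  have fin: "finite {n. g n \<noteq> 0}" and le: "ell2_norm g \<le> 1"
    using assms by (auto simp: finsupp_unit_ball_def)
  from fin obtain M where M: "\<forall>n\<in>{n. g n \<noteq> 0}. n < M"
    using finite_nat_set_iff_bounded by blast
  then have z: "g n = 0" if "M \<le> M'" "M' \<le> n" for M' n
    using that by force
  moreover have "(\<Sum>n<M'. (cmod (g n))\<^sup>2) \<le> 1" if "M \<le> M'" for M'
    using le ell2_norm_finsupp(2)[of M' g] z that by auto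
  ultimately show thesis using that by blast
qed

lemma matrix_norm_lacunary_hankel_le:
  fixes k :: "nat \<Rightarrow> nat"
  assumes k: "strict_mono k" and lac: "\<And>j. k (Suc j) > 2 * k j" and v: "v \<in> ell2"
  shows "matrix_norm (lacunary_hankel k v) \<le> ereal (sqrt 2 * ell2_norm v)"
  unfolding matrix_norm_def
proof (rule SUP_least, clarify)
  fix g h :: "nat \<Rightarrow> complex"
  assume g: "g \<in> finsupp_unit_ball" and h: "h \<in> finsupp_unit_ball"
  obtain G where G: "\<And>M n. G \<le> M \<Longrightarrow> M \<le> n \<Longrightarrow> g n = 0"
      "\<And>M. G \<le> M \<Longrightarrow> (\<Sum>n<M. (cmod (g n))\<^sup>2) \<le> 1"
    using finsupp_unit_ballE[OF g] by blast
  obtain H where H: "\<And>M n. H \<le> M \<Longrightarrow> M \<le> n \<Longrightarrow> h n = 0"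
      "\<And>M. H \<le> M \<Longrightarrow> (\<Sum>n<M. (cmod (h n))\<^sup>2) \<le> 1"
    using finsupp_unit_ballE[OF h] by blast
  define M where "M = max G H"
  have "cmod (\<Sum>m. \<Sum>n. lacunary_hankel k v m n * g m * h n) \<le>
         root_sum v (2 * M) * (((\<Sum>n<M. (cmod (g n))\<^sup>2) + (\<Sum>n<M. (cmod (h n))\<^sup>2)) / 2)"
    by (rule lacunary_hankel_form_le[OF k lac]) (auto simp: M_def G(1)[of M] H(1)[of M])
  also have "\<dots> \<le> root_sum v (2 * M) * 1"
    using G(2)[of M] H(2)[of M] by (intro mult_left_mono root_sum_nonneg) (auto simp: M_def)
  also have "\<dots> \<le> sqrt 2 * ell2_norm v"
    using root_sum_le_ell2_norm[OF v] by simp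
  finally show "ereal (cmod (\<Sum>m. \<Sum>n. lacunary_hankel k v m n * g m * h n)) \<le>
      ereal (sqrt 2 * ell2_norm v)" by simp
qed

section \<open>Sharpness of the constant\<close>

text \<open>The vector \<open>w\<close> of the overview, cut to vertices reached from 0 by labels 1
  to \<open>N\<close>. Stage \<open>Suc N\<close> adds the scaled reflection
  \<open>n \<mapsto> k (Suc N) - n\<close> of the previous stage, which crosses the edges with the
  new label. Label 0 is left out, its coefficient being \<open>sqrt 0 = 0\<close>.\<close>

primrec tree_vector :: "(nat \<Rightarrow> nat) \<Rightarrow> nat \<Rightarrow> nat \<Rightarrow> real" where
  "tree_vector k 0 n = (if n = 0 then 1 else 0)"
| "tree_vector k (Suc N) n = tree_vector k N n +
     (if n \<le> k (Suc N) then tree_vector k N (k (Suc N) - n) / sqrt (Suc N) else 0)"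

lemma tree_vector_nonneg: "0 \<le> tree_vector k N n"
  by (induction N arbitrary: n) auto

lemma tree_vector_Suc_mono: "tree_vector k N n \<le> tree_vector k (Suc N) n"
  by (simp add: tree_vector_nonneg)

lemma tree_vector_eq_0:
  assumes "strict_mono k" and "k N < n"
  shows "tree_vector k N n = 0"
  using assms(2)
proof (induction N arbitrary: n)
  case (Suc N)
  moreover have "k N < k (Suc N)" using assms(1) by (simp add: strict_mono_Suc_iff)
  ultimately show ?case by simp
qed simp

text \<open>Since \<open>k (Suc N) > 2 * k N\<close>, the reflected copy and the previous stage have
  disjoint supports, and the copy adds \<open>(N + 1) / Suc N = 1\<close> to the squared
  norm.\<close>

lemma tree_vector_sum_sq:
  fixes k :: "nat \<Rightarrow> nat"
  assumes k: "strict_mono k" and lac: "\<And>j. k (Suc j) > 2 * k j"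
  shows "(\<Sum>n\<le>k N. (tree_vector k N n)\<^sup>2) = real N + 1"
proof (induction N)
  case 0
  have "(\<Sum>n\<le>k 0. (tree_vector k 0 n)\<^sup>2) = (\<Sum>n\<le>k 0. if n = 0 then 1 else 0)"
    by (intro sum.cong) auto
  then show ?case by simp
next
  case (Suc N)
  define K W where "K = k (Suc N)" and "W = tree_vector k N"
  have "k N \<le> K" using lac[of N] by (simp add: K_def)
  then have W: "(\<Sum>n\<le>K. (W n)\<^sup>2) = real N + 1"
    unfolding Suc.IH[symmetric] W_def
    by (intro sum.mono_neutral_right) (auto simp: tree_vector_eq_0[OF k])
  have disjoint_support: "W n * W (K - n) = 0" for n
  proof -
    have "k N < n \<or> k N < K - n" using lac[of N] by (auto simp: K_def)
    then show ?thesis by (auto simp: W_def tree_vector_eq_0[OF k])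
  qed
  have "(tree_vector k (Suc N) n)\<^sup>2 = (W n)\<^sup>2 + (W (K - n))\<^sup>2 / real (Suc N)" if "n \<le> K" for n
  proof -
    have "(tree_vector k (Suc N) n)\<^sup>2 = (W n + W (K - n) / sqrt (Suc N))\<^sup>2"
      using that by (simp add: W_def K_def)
    also have "\<dots> = (W n)\<^sup>2 + (W (K - n))\<^sup>2 / real (Suc N) + 2 * (W n * W (K - n)) / sqrt (Suc N)"
      by (simp add: power2_sum power_divide)
    finally show ?thesis by (simp add: disjoint_support)
  qed
  then have "(\<Sum>n\<le>K. (tree_vector k (Suc N) n)\<^sup>2) =
      (\<Sum>n\<le>K. (W n)\<^sup>2) + (\<Sum>n\<le>K. (W (K - n))\<^sup>2) / real (Suc N)"
    by (simp add: sum.distrib sum_divide_distrib)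
  also have "\<dots> = real (Suc N) + 1"
    using sum_atMost_reflect[of "\<lambda>n. (W n)\<^sup>2" K] by (simp add: W add.commute)
  finally show ?case by (simp add: K_def)
qed

text \<open>Passing to stage \<open>Suc N\<close> does not lower the terms with old labels, and the
  new label contributes at least \<open>2 * (N + 1)\<close>, exactly the increment of
  \<open>N * (N + 1)\<close>.\<close>

lemma tree_vector_form_ge:
  fixes k :: "nat \<Rightarrow> nat"
  assumes k: "strict_mono k" and lac: "\<And>j. k (Suc j) > 2 * k j"
  shows "real N * (real N + 1) \<le>
    (\<Sum>i\<le>N. sqrt i * (\<Sum>m\<le>k i. tree_vector k N m * tree_vector k N (k i - m)))"
proof (induction N)
  case (Suc N)
  define K W where "K = k (Suc N)" and "W = tree_vector k N"
  have "k N \<le> K" using lac[of N] by (simp add: K_def)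
  then have W: "(\<Sum>n\<le>K. (W n)\<^sup>2) = real N + 1"
    unfolding tree_vector_sum_sq[OF k lac, symmetric] W_def
    by (intro sum.mono_neutral_right) (auto simp: tree_vector_eq_0[OF k])
  have pointwise: "((W m)\<^sup>2 + (W (K - m))\<^sup>2) / sqrt (Suc N) \<le>
      tree_vector k (Suc N) m * tree_vector k (Suc N) (K - m)" if "m \<le> K" for m
  proof -
    \<comment> \<open>The new entries at the two endpoints are \<open>x + r * y\<close> and
      \<open>y + r * x\<close>; the mixed terms of their product are nonnegative and are
      dropped.\<close>
    define x y r where "x = W m" and "y = W (K - m)" and "r = 1 / sqrt (Suc N)"
    have "0 \<le> x" "0 \<le> y" "0 \<le> r"
      by (auto simp: x_def y_def r_def W_def tree_vector_nonneg)
    then have "r * (x\<^sup>2 + y\<^sup>2) \<le> r * (x\<^sup>2 + y\<^sup>2) + (x * y + r * r * (x * y))"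
      by simp
    also have "\<dots> = (x + r * y) * (y + r * x)"
      by (simp add: power2_eq_square algebra_simps)
    finally show ?thesis
      using that by (simp add: x_def y_def r_def W_def K_def)
  qed
  \<comment> \<open>Both \<open>W\<close> and its reversal have squared norm \<open>N + 1\<close>,
    and the coefficient \<open>sqrt (Suc N)\<close> cancels the scaling.\<close>
  have "2 * (real N + 1) = ((\<Sum>m\<le>K. (W m)\<^sup>2) + (\<Sum>m\<le>K. (W (K - m))\<^sup>2))"
    using sum_atMost_reflect[of "\<lambda>n. (W n)\<^sup>2" K] W by simp
  also have "\<dots> = sqrt (Suc N) * (\<Sum>m\<le>K. ((W m)\<^sup>2 + (W (K - m))\<^sup>2) / sqrt (Suc N))"
    by (simp add: sum.distrib flip: sum_divide_distrib)
  also have "\<dots> \<le> sqrt (Suc N) *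
      (\<Sum>m\<le>K. tree_vector k (Suc N) m * tree_vector k (Suc N) (K - m))"
    by (intro mult_left_mono sum_mono pointwise) auto
  finally have top: "2 * (real N + 1) \<le> \<dots>" .
  \<comment> \<open>Entries are nonnegative and never decrease with the stage.\<close>
  have "(\<Sum>i\<le>N. sqrt i * (\<Sum>m\<le>k i. tree_vector k N m * tree_vector k N (k i - m))) \<le>
    (\<Sum>i\<le>N. sqrt i * (\<Sum>m\<le>k i. tree_vector k (Suc N) m * tree_vector k (Suc N) (k i - m)))"
    by (intro sum_mono mult_left_mono mult_mono tree_vector_Suc_mono tree_vector_nonneg) auto
  then have "real N * (real N + 1) + 2 * (real N + 1) \<le>
    (\<Sum>i\<le>Suc N. sqrt i * (\<Sum>m\<le>k i. tree_vector k (Suc N) m * tree_vector k (Suc N) (k i - m)))"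
    using Suc.IH top unfolding sum.atMost_Suc K_def by linarith
  then show ?case by (simp add: algebra_simps)
qed simp

text \<open>The normalised tree vector serves as both \<open>g\<close> and \<open>h\<close>: the
  form is at least \<open>N * (N + 1)\<close> before division by the squared norm
  \<open>N + 1\<close>.\<close>

lemma matrix_norm_lacunary_hankel_sqrt_ge:
  fixes k :: "nat \<Rightarrow> nat" and N :: nat
  assumes k: "strict_mono k" and lac: "\<And>j. k (Suc j) > 2 * k j"
  defines "v \<equiv> \<lambda>i. if i \<le> N then complex_of_real (sqrt i) else 0"
  shows "ereal (real N) \<le> matrix_norm (lacunary_hankel k v)"
proof -
  define W where "W = tree_vector k N"
  define M where "M = Suc (k N)"
  define g where "g n = complex_of_real (W n / sqrt (real N + 1))" for n
  have g0: "g n = 0" if "n \<ge> M" for n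
    using that by (simp add: g_def W_def M_def tree_vector_eq_0[OF k])
  have "(\<Sum>n<M. (cmod (g n))\<^sup>2) = (\<Sum>n\<le>k N. (W n)\<^sup>2) / (real N + 1)"
    unfolding M_def lessThan_Suc_atMost sum_divide_distrib
    by (intro sum.cong) (auto simp: g_def norm_divide power_divide)
  also have "\<dots> = 1"
    unfolding W_def tree_vector_sum_sq[OF k lac] by simp
  finally have "(\<Sum>n<M. (cmod (g n))\<^sup>2) = 1" .
  moreover have "finite {n. g n \<noteq> 0}"
    by (rule finite_subset[of _ "{..<M}"]) (use g0 in \<open>auto simp: not_le[symmetric]\<close>)
  ultimately have g: "g \<in> finsupp_unit_ball"
    using ell2_norm_finsupp[of M g] g0 by (simp add: finsupp_unit_ball_def)
  have N: "N \<le> k N" by (rule strict_mono_imp_increasing[OF k])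
  have "(\<Sum>m. \<Sum>n. lacunary_hankel k v m n * g m * g n) =
      (\<Sum>i<2*M. v i * (\<Sum>m\<le>k i. g m * g (k i - m)))"
    by (rule lacunary_hankel_form[OF k g0 g0])
  \<comment> \<open>\<open>v\<close> vanishes beyond \<open>N\<close>, and
    \<open>N \<le> k N < 2 * M\<close> keeps all labels up to \<open>N\<close> in range.\<close>
  also have "\<dots> = (\<Sum>i\<le>N. v i * (\<Sum>m\<le>k i. g m * g (k i - m)))"
    using N by (intro sum.mono_neutral_right) (auto simp: v_def M_def)
  also have "\<dots> = (\<Sum>i\<le>N. sqrt i * (\<Sum>m\<le>k i. g m * g (k i - m)))"
    by (intro sum.cong) (auto simp: v_def)
  also have "\<dots> = complex_of_real ((\<Sum>i\<le>N. sqrt i * (\<Sum>m\<le>k i. W m * W (k i - m))) / (real N + 1))"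
  proof -
    have "g m * g n = complex_of_real (W m * W n / (real N + 1))" for m n
    proof -
      have "W m / sqrt (real N + 1) * (W n / sqrt (real N + 1)) = W m * W n / (real N + 1)"
        by simp
      then show ?thesis by (simp only: g_def flip: of_real_mult)
    qed
    then show ?thesis
      by (simp only: sum_divide_distrib times_divide_eq_right sum_distrib_left
          flip: of_real_sum of_real_mult)
  qed
  finally have form: "(\<Sum>m. \<Sum>n. lacunary_hankel k v m n * g m * g n) = \<dots>" .
  have "real N \<le> (\<Sum>i\<le>N. sqrt i * (\<Sum>m\<le>k i. W m * W (k i - m))) / (real N + 1)"
    using tree_vector_form_ge[OF k lac, of N] by (simp add: W_def le_divide_eq)
  then have "real N \<le> cmod (\<Sum>m. \<Sum>n. lacunary_hankel k v m n * g m * g n)"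
    unfolding form norm_of_real by linarith
  then have "ereal (real N) \<le> ereal (cmod (\<Sum>m. \<Sum>n. lacunary_hankel k v m n * g m * g n))"
    by simp
  also have "\<dots> \<le> matrix_norm (lacunary_hankel k v)"
    unfolding matrix_norm_def by (rule SUP_upper2[of "(g, g)"]) (use g in auto)
  finally show ?thesis .
qed

text \<open>The square-root coefficients force \<open>C\<close> to be at least
  \<open>N / ell2_norm v = sqrt (2 * (N / (N + 1)))\<close> for every positive \<open>N\<close>, and
  this tends to \<open>sqrt 2\<close>.\<close>

lemma lacunary_hankel_constant_ge:
  fixes k :: "nat \<Rightarrow> nat" and C :: real
  assumes k: "strict_mono k" and lac: "\<And>j. k (Suc j) > 2 * k j"
    and C: "\<And>v. v \<in> ell2 \<Longrightarrow> matrix_norm (lacunary_hankel k v) \<le> ereal (C * ell2_norm v)"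
  shows "sqrt 2 \<le> C"
proof -
  have bound: "sqrt (2 * (real N / real (Suc N))) \<le> C" if "N > 0" for N
  proof -
    define v where "v i = (if i \<le> N then complex_of_real (sqrt i) else 0)" for i
    have v0: "v n = 0" if "n \<ge> Suc N" for n
      using that by (simp add: v_def)
    have "(\<Sum>n<Suc N. (cmod (v n))\<^sup>2) = real (\<Sum>n\<le>N. n)"
      unfolding lessThan_Suc_atMost of_nat_sum by (intro sum.cong) (auto simp: v_def)
    also have "\<dots> = real N * real (Suc N) / 2"
      using double_gauss_sum[of N, where ?'a = real] by (simp add: atMost_atLeast0 algebra_simps)
    finally have norm_v: "ell2_norm v = sqrt (real N * real (Suc N) / 2)"
      using ell2_norm_finsupp(2)[of "Suc N" v] v0 by simp
    have "ereal (real N) \<le> ereal (C * ell2_norm v)"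
      using matrix_norm_lacunary_hankel_sqrt_ge[OF k lac, of N] C[of v]
        ell2_norm_finsupp(1)[of "Suc N" v] v0 unfolding v_def[abs_def] by (meson order_trans)
    then have "real N \<le> C * sqrt (real N * real (Suc N) / 2)"
      by (simp only: ereal_less_eq norm_v)
    \<comment> \<open>Exhibits \<open>ell2_norm v\<close> as a common factor of both sides; it is
      positive for \<open>N > 0\<close> and cancels.\<close>
    moreover have "real N = sqrt (2 * (real N / real (Suc N))) * sqrt (real N * real (Suc N) / 2)"
      by (simp flip: real_sqrt_mult)
    moreover have "0 < sqrt (real N * real (Suc N) / 2)"
      using that by simp
    ultimately show ?thesis
      by (metis mult_le_cancel_right_pos)
  qed
  have "(\<lambda>N. sqrt (2 * (real N / real (Suc N)))) \<longlonglongrightarrow> sqrt (2 * 1)"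
    by (intro tendsto_intros LIMSEQ_n_over_Suc_n)
  then have "sqrt (2 * 1) \<le> C"
    by (rule LIMSEQ_le_const2) (use bound in \<open>auto intro!: exI[of _ 1]\<close>)
  then show ?thesis by simp
qed

theorem mainTheorem4:
  fixes k :: "nat \<Rightarrow> nat"
  assumes "strict_mono k"
    and "\<And>j. k (Suc j) > 2 * k j"
  shows "(\<forall>v\<in>ell2. matrix_norm (lacunary_hankel k v) \<le> ereal (sqrt 2 * ell2_norm v)) \<and>
         (\<forall>C::real. (\<forall>v\<in>ell2. matrix_norm (lacunary_hankel k v) \<le> ereal (C * ell2_norm v))
            \<longrightarrow> sqrt 2 \<le> C)"
proof (intro conjI ballI allI impI)
  show "matrix_norm (lacunary_hankel k v) \<le> ereal (sqrt 2 * ell2_norm v)" if "v \<in> ell2" for v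
    by (rule matrix_norm_lacunary_hankel_le[OF assms that])
  show "sqrt 2 \<le> C"
    if "\<forall>v\<in>ell2. matrix_norm (lacunary_hankel k v) \<le> ereal (C * ell2_norm v)" for C
    by (rule lacunary_hankel_constant_ge[OF assms bspec[OF that]])
qed

end
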